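(* There exists a Tychonoff space $X$ which has a dense Lindelöf subspace but is not set star-Lindelöf.
   Context: For a subset $A$ of a space $X$ and a collection $\mathcal{U}$ of subsets of $X$, put $\mathrm{St}(A,\mathcal{U})=\bigcup\{U\in\mathcal{U}: U\cap A\neq\emptyset\}$. A space $X$ is set star-Lindelöf if for each nonempty subset $A$ of $X$ and each collection $\mathcal{U}$ of open sets in $X$ such that $\overline{A}\subseteq\bigcup\mathcal{U}$, there is a countable subset $\mathcal{V}$ of $\mathcal{U}$ such that $A\subseteq\mathrm{St}(\bigcup\mathcal{V},\mathcal{U})$. *)

theory Defs
  imports "HOL-Analysis.Analysis"
begin

definition St :: "'a set \<Rightarrow> 'a set set \<Rightarrow> 'a set" where
  "St A \<U> = \<Union>{U \<in> \<U>. U \<inter> A \<noteq> {}}"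

definition set_star_Lindelof_space :: "'a topology \<Rightarrow> bool" where
  "set_star_Lindelof_space X \<longleftrightarrow>
     (\<forall>A \<U>. A \<noteq> {} \<and> A \<subseteq> topspace X \<and> (\<forall>U\<in>\<U>. openin X U) \<and> X closure_of A \<subseteq> \<Union>\<U>
        \<longrightarrow> (\<exists>\<V>. countable \<V> \<and> \<V> \<subseteq> \<U> \<and> A \<subseteq> St (\<Union>\<V>) \<U>))"

definition Tychonoff_space :: "'a topology \<Rightarrow> bool" where
  "Tychonoff_space X \<longleftrightarrow> t1_space X \<and> completely_regular_space X"

end

(* The space is the deleted Tychonoff plank over a discrete set of size continuum: the product of
   the one-point compactifications of the discrete spaces of reals and of naturals, without the
   corner point (None, None). The columns over the naturals are compact, and their union is dense.
   The top edge is closed, and the vertical lines over the reals are pairwise disjoint open sets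
   covering it, each meeting it in one point; so the star of a countable union of such lines is
   that same union and misses most of the edge. *)
theory Submission
  imports Defs
begin

text \<open>An injection carries the topology to its image: pulling back along the inverse makes
  exactly the images of open sets open. This serves to copy the plank onto a set of reals.\<close>

lemma homeomorphic_map_pullback_topology:
  assumes "inj_on f (topspace X)"
  shows "homeomorphic_map X
           (pullback_topology (f ` topspace X) (inv_into (topspace X) f) X) f"
    (is "homeomorphic_map X ?Y f")
proof -
  let ?g = "inv_into (topspace X) f"
  have gf: "?g (f x) = x" if "x \<in> topspace X" for x
    using assms that by simp
  have top: "topspace ?Y = f ` topspace X"
    using gf by (auto simp: topspace_pullback_topology)
  have "continuous_map ?Y X ?g"
    unfolding continuous_map_def
  proof (intro conjI allI impI)
    show "?g \<in> topspace ?Y \<rightarrow> topspace X"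
      using gf top by auto
    fix U assume "openin X U"
    moreover have "{y \<in> topspace ?Y. ?g y \<in> U} = ?g -` U \<inter> f ` topspace X"
      using top by auto
    ultimately show "openin ?Y {y \<in> topspace ?Y. ?g y \<in> U}"
      by (auto simp: openin_pullback_topology)
  qed
  moreover have "continuous_map X ?Y f"
    unfolding continuous_map_def
  proof (intro conjI allI impI)
    show "f \<in> topspace X \<rightarrow> topspace ?Y"
      using top by auto
    fix V assume "openin ?Y V"
    then obtain U where U: "openin X U" "V = ?g -` U \<inter> f ` topspace X"
      by (auto simp: openin_pullback_topology)
    have "f x \<in> V \<longleftrightarrow> x \<in> U" if "x \<in> topspace X" for x
      using that by (simp add: U(2) gf)
    then have "{x \<in> topspace X. f x \<in> V} = U"
      using openin_subset[OF U(1)] by blast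
    then show "openin X {x \<in> topspace X. f x \<in> V}"
      using U by simp
  qed
  ultimately have "homeomorphic_maps X ?Y f ?g"
    using gf top by (auto simp: homeomorphic_maps_def)
  then show ?thesis
    using homeomorphic_maps_map by blast
qed

text \<open>Open families and closures are pushed forward along \<open>f\<close>, and the countable
  subfamily found in \<open>Y\<close> is pulled back. It is used in contrapositive form, to pass the
  failure on the plank to its copy.\<close>

lemma set_star_Lindelof_space_homeomorphic_map:
  assumes f: "homeomorphic_map X Y f" and Y: "set_star_Lindelof_space Y"
  shows "set_star_Lindelof_space X"
  unfolding set_star_Lindelof_space_def
proof (intro allI impI, elim conjE)
  fix A \<U>
  assume A: "A \<noteq> {}" "A \<subseteq> topspace X" and \<U>: "\<forall>U\<in>\<U>. openin X U"
    and cl: "X closure_of A \<subseteq> \<Union>\<U>"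
  have inj: "inj_on f (topspace X)"
    using f homeomorphic_imp_injective_map by blast
  have sub: "U \<subseteq> topspace X" if "U \<in> \<U>" for U
    using \<U> that openin_subset by blast
  have "f ` A \<subseteq> topspace Y"
    using f A homeomorphic_imp_surjective_map by blast
  moreover have "\<forall>V\<in>(`) f ` \<U>. openin Y V"
    using f \<U> homeomorphic_imp_open_map open_map_def by blast
  moreover have "Y closure_of (f ` A) \<subseteq> \<Union>((`) f ` \<U>)"
    using homeomorphic_map_closure_of[OF f A(2)] cl by (metis image_Union image_mono)
  ultimately obtain \<W> where \<W>: "countable \<W>" "\<W> \<subseteq> (`) f ` \<U>"
      "f ` A \<subseteq> St (\<Union>\<W>) ((`) f ` \<U>)"
    using Y A(1) unfolding set_star_Lindelof_space_def by (metis image_is_empty)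
  then obtain \<V> where \<V>: "countable \<V>" "\<V> \<subseteq> \<U>" "\<W> = (`) f ` \<V>"
    by (meson countable_subset_image)
  have "A \<subseteq> St (\<Union>\<V>) \<U>"
  proof
    fix a assume a: "a \<in> A"
    then have "f a \<in> St (\<Union>\<W>) ((`) f ` \<U>)"
      using \<W>(3) by blast
    then obtain U V where UV: "U \<in> \<U>" "f a \<in> f ` U" "V \<in> \<V>" "f ` U \<inter> f ` V \<noteq> {}"
      unfolding St_def \<V>(3) by blast
    have "V \<subseteq> topspace X"
      using UV(3) \<V>(2) sub by blast
    \<comment> \<open>Both facts need injectivity: a common point of the images, and the point
      \<open>f a\<close>, each have only one preimage in the carrier.\<close>
    then have "U \<inter> V \<noteq> {}" "a \<in> U"
      using UV sub[OF UV(1)] inj a A(2) by (auto dest: inj_onD)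
    then show "a \<in> St (\<Union>\<V>) \<U>"
      using UV unfolding St_def by blast
  qed
  then show "\<exists>\<V>. countable \<V> \<and> \<V> \<subseteq> \<U> \<and> A \<subseteq> St (\<Union>\<V>) \<U>"
    using \<V> by blast
qed

text \<open>As \<open>A\<close> is its own closure, the sets \<open>U a\<close> form an admissible
  cover. A countable subfamily is indexed by a countable \<open>B\<close>; disjointness makes its
  star meet \<open>A\<close> only in points of \<open>B\<close>, so \<open>A\<close> would be
  countable.\<close>

lemma uncountable_disjoint_cover_imp_not_set_star_Lindelof:
  assumes A: "closedin X A" "uncountable A"
    and U: "\<And>a. a \<in> A \<Longrightarrow> openin X (U a)" "\<And>a. a \<in> A \<Longrightarrow> a \<in> U a"
    and disj: "disjoint_family_on U A"
  shows "\<not> set_star_Lindelof_space X"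
proof
  assume "set_star_Lindelof_space X"
  moreover have "A \<noteq> {}" "A \<subseteq> topspace X" "X closure_of A \<subseteq> \<Union>(U ` A)"
    using A U closedin_subset[OF A(1)] by (auto simp: closure_of_closedin)
  moreover have "\<forall>V\<in>U ` A. openin X V"
    using U by blast
  ultimately obtain \<V> where "countable \<V>" "\<V> \<subseteq> U ` A" and star: "A \<subseteq> St (\<Union>\<V>) (U ` A)"
    unfolding set_star_Lindelof_space_def by meson
  then obtain B where B: "countable B" "B \<subseteq> A" "\<V> = U ` B"
    by (meson countable_subset_image)
  have "A \<subseteq> B"
  proof
    fix a assume a: "a \<in> A"
    then obtain a' b where "a' \<in> A" "a \<in> U a'" "b \<in> B" "U a' \<inter> U b \<noteq> {}"
      using star unfolding St_def B(3) by blast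
    \<comment> \<open>\<open>a\<close> lies in both \<open>U a\<close> and \<open>U a'\<close>, so
      \<open>a = a'\<close>; since \<open>U a'\<close> meets \<open>U b\<close>, also
      \<open>a' = b\<close>.\<close>
    then show "a \<in> B"
      using disj a U(2) B(2) unfolding disjoint_family_on_def by (metis disjoint_iff subsetD)
  qed
  then show False
    using A(2) B(1) countable_subset by blast
qed

definition discrete_plank :: "('a option \<times> 'b option) topology" where
  "discrete_plank = prod_topology (Alexandroff_compactification (discrete_topology UNIV))
                                  (Alexandroff_compactification (discrete_topology UNIV))"

text \<open>For infinite \<open>'a\<close> the corner is a limit of the edge
  \<open>range Some \<times> {None}\<close> in the full plank; deleting it makes that edge
  closed.\<close>

definition deleted_discrete_plank :: "('a option \<times> 'b option) topology" where
  "deleted_discrete_plank = subtopology discrete_plank (- {(None, None)})"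

lemma topspace_Alexandroff_discrete [simp]:
  "topspace (Alexandroff_compactification (discrete_topology UNIV)) = UNIV"
  by (simp flip: UNIV_option_conv)

lemma topspace_discrete_plank [simp]: "topspace discrete_plank = UNIV"
  by (simp add: discrete_plank_def flip: UNIV_option_conv)

text \<open>Discrete spaces are locally compact Hausdorff, so both compactifications are Hausdorff
  and completely regular; products and subspaces inherit this.\<close>

lemma Tychonoff_space_deleted_discrete_plank: "Tychonoff_space deleted_discrete_plank"
proof -
  have "Hausdorff_space discrete_plank" "completely_regular_space discrete_plank"
    by (simp_all add: discrete_plank_def Hausdorff_space_prod_topology
        Hausdorff_space_Alexandroff_compactification completely_regular_space_prod_topology
        completely_regular_space_Alexandroff_compactification
        completely_regular_space_discrete_topology locally_compact_space_discrete_topology)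
  then show ?thesis
    unfolding Tychonoff_space_def deleted_discrete_plank_def
    by (blast intro: Hausdorff_imp_t1_space Hausdorff_space_subtopology
        completely_regular_space_subtopology)
qed

text \<open>An infinite discrete space is not compact, hence dense in its one-point
  compactification, and a product of dense sets is dense.\<close>

lemma closure_of_deleted_discrete_plank:
  assumes "infinite (UNIV :: 'b set)"
  shows "(deleted_discrete_plank :: ('a option \<times> 'b option) topology) closure_of (UNIV \<times> range Some) =
         topspace deleted_discrete_plank"
proof -
  let ?K = "Alexandroff_compactification (discrete_topology UNIV)"
  have "\<not> compact_space (discrete_topology (UNIV :: 'b set))"
    using assms by (simp add: compact_space_discrete_topology)
  then have "?K closure_of (range Some :: 'b option set) = UNIV"
    using Alexandroff_compactification_dense[of "discrete_topology (UNIV :: 'b set)"]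
    by (simp flip: UNIV_option_conv)
  moreover have "?K closure_of (UNIV :: 'a option set) = UNIV"
    using closure_of_topspace[of "?K :: 'a option topology"]
    by (simp flip: UNIV_option_conv)
  ultimately have "discrete_plank closure_of (UNIV \<times> range Some :: ('a option \<times> 'b option) set) = UNIV"
    by (simp add: discrete_plank_def closure_of_Times)
  \<comment> \<open>The dense set avoids the corner, so deleting the corner removes none of
    it.\<close>
  moreover have "- {(None, None)} \<inter> UNIV \<times> range Some =
                   (UNIV \<times> range Some :: ('a option \<times> 'b option) set)"
    by auto
  ultimately show ?thesis
    by (simp add: deleted_discrete_plank_def closure_of_subtopology)
qed

text \<open>The subspace is the union of the countably many compact sets
  \<open>UNIV \<times> {Some n}\<close>.\<close>

lemma Lindelof_space_deleted_discrete_plank: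
  assumes "countable (UNIV :: 'b set)"
  shows "Lindelof_space (subtopology (deleted_discrete_plank :: ('a option \<times> 'b option) topology)
                                     (UNIV \<times> range Some))"
proof -
  let ?P = "discrete_plank :: ('a option \<times> 'b option) topology"
  let ?C = "\<lambda>n :: 'b. UNIV \<times> {Some n} :: ('a option \<times> 'b option) set"
  have "compactin (Alexandroff_compactification (discrete_topology UNIV)) (UNIV :: 'a option set)"
    by (metis compact_space_Alexandroff_compactification compact_space_def
        topspace_Alexandroff_discrete)
  then have "compactin ?P (?C n)" for n
    by (simp add: discrete_plank_def compactin_Times)
  then have "Lindelof_space (subtopology ?P (?C n))" for n
    by (simp add: compact_imp_Lindelof_space compact_space_subtopology)
  moreover have "countable (range ?C)"
    using assms by simp
  ultimately have "Lindelof_space (subtopology ?P (\<Union>(range ?C)))"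
    by (intro Lindelof_space_Union) auto
  moreover have "- {(None, None)} \<inter> UNIV \<times> range Some = \<Union>(range ?C)"
    by auto
  ultimately show ?thesis
    by (simp add: deleted_discrete_plank_def subtopology_subtopology)
qed

lemma not_set_star_Lindelof_deleted_discrete_plank:
  assumes "uncountable (UNIV :: 'a set)"
  shows "\<not> set_star_Lindelof_space (deleted_discrete_plank :: ('a option \<times> 'b option) topology)"
proof (rule uncountable_disjoint_cover_imp_not_set_star_Lindelof)
  let ?P = "discrete_plank :: ('a option \<times> 'b option) topology"
  let ?A = "range Some \<times> {None} :: ('a option \<times> 'b option) set"
  let ?U = "\<lambda>p. {fst p} \<times> UNIV :: ('a option \<times> 'b option) set"
  have "t1_space (Alexandroff_compactification (discrete_topology (UNIV :: 'b set)))"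
    by (simp add: Hausdorff_imp_t1_space)
  then have "closedin ?P (UNIV \<times> {None})"
    by (auto simp: discrete_plank_def closedin_prod_Times_iff closedin_t1_singleton)
       (metis closedin_topspace topspace_Alexandroff_discrete)
  \<comment> \<open>The edge is the trace of a closed set of the full plank.\<close>
  moreover have "?A = UNIV \<times> {None} \<inter> - {(None, None)}"
    by (auto simp: UNIV_option_conv)
  ultimately show "closedin deleted_discrete_plank ?A"
    by (auto simp: deleted_discrete_plank_def closedin_subtopology)
  have "inj (\<lambda>x. (Some x, None) :: 'a option \<times> 'b option)"
    by (auto simp: inj_on_def)
  moreover have "?A = range (\<lambda>x. (Some x, None))"
    by auto
  ultimately show "uncountable ?A"
    using assms by (metis countable_image_inj_on)
  show "openin deleted_discrete_plank (?U p)" if p: "p \<in> ?A" for p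
  proof -
    obtain x where x: "fst p = Some x"
      using p by auto
    \<comment> \<open>Every point other than \<open>None\<close> is isolated in the first factor, so
      the line through it is open.\<close>
    have "openin (Alexandroff_compactification (discrete_topology UNIV)) (Some ` {x})"
      by (subst openin_Alexandroff_compactification_image_Some) simp
    moreover have "openin (Alexandroff_compactification (discrete_topology UNIV)) (UNIV :: 'b option set)"
      by (metis openin_topspace topspace_Alexandroff_discrete)
    ultimately have "openin ?P (?U p)"
      by (simp add: x discrete_plank_def openin_prod_Times_iff)
    moreover have "?U p \<subseteq> - {(None, None)}"
      using x by auto
    ultimately show ?thesis
      by (auto simp: deleted_discrete_plank_def openin_subtopology)
  qed
  show "p \<in> ?U p" for p
    by (cases p) auto
  show "disjoint_family_on ?U ?A"
    by (auto simp: disjoint_family_on_def)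
qed

text \<open>The integer part of the image encodes the second coordinate and the fractional part the
  first.\<close>

lemma inj_real_option_nat_option: "\<exists>f :: real option \<times> nat option \<Rightarrow> real. inj f"
proof -
  \<comment> \<open>The logistic expression is strictly decreasing with values strictly between 0
    and 1, which leaves 0 free for \<open>None\<close>.\<close>
  define h :: "real option \<Rightarrow> real" where
    "h y = (case y of None \<Rightarrow> 0 | Some x \<Rightarrow> 1 / (1 + exp x))" for y
  have h01: "0 \<le> h y" "h y < 1" for y
    by (auto simp: h_def field_simps add_pos_pos split: option.split)
  have pos: "1 + exp x \<noteq> 0" for x :: real
    using exp_gt_zero[of x] by linarith
  have "inj h"
    by (auto simp: inj_on_def h_def pos split: option.splits)
  define f :: "real option \<times> nat option \<Rightarrow> real" where
    "f p = of_nat (to_nat (snd p)) + h (fst p)" for p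
  have floor_f: "\<lfloor>f p\<rfloor> = int (to_nat (snd p))" for p
    using h01[of "fst p"] by (simp add: f_def floor_eq_iff)
  have "inj f"
  proof (rule injI)
    fix p q assume eq: "f p = f q"
    then have "to_nat (snd p) = to_nat (snd q)"
      using floor_f by (metis of_nat_eq_iff)
    then show "p = q"
      using eq \<open>inj h\<close> by (simp add: f_def inj_eq prod_eq_iff)
  qed
  then show ?thesis
    by blast
qed

(* HOL cannot quantify over types inside a formula, so the space is sought with its points
   among the reals: its carrier topspace X is an arbitrary set of reals, and its topology is
   unrelated to the usual one. *)
theorem mainTheorem2:
  shows "\<exists>X :: real topology.
           Tychonoff_space X \<and>
           (\<exists>D. D \<subseteq> topspace X \<and> X closure_of D = topspace X \<and>
                Lindelof_space (subtopology X D)) \<and>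
           \<not> set_star_Lindelof_space X"
proof -
  let ?X = "deleted_discrete_plank :: (real option \<times> nat option) topology"
  let ?D = "UNIV \<times> range Some :: (real option \<times> nat option) set"
  obtain f :: "real option \<times> nat option \<Rightarrow> real" where "inj f"
    using inj_real_option_nat_option by blast
  \<comment> \<open>\<open>Y\<close> is the copy of the deleted plank inside the reals; each
    required property is transported along \<open>f\<close>.\<close>
  then obtain Y where f: "homeomorphic_map ?X Y f"
    using homeomorphic_map_pullback_topology by (metis inj_on_subset subset_UNIV)
  have D: "?D \<subseteq> topspace ?X"
    by (auto simp: deleted_discrete_plank_def)
  have "Tychonoff_space Y"
    using Tychonoff_space_deleted_discrete_plank f homeomorphic_map_imp_homeomorphic_space
      homeomorphic_t1_space homeomorphic_completely_regular_space
    unfolding Tychonoff_space_def by metis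
  moreover have "f ` ?D \<subseteq> topspace Y"
    using D f homeomorphic_imp_surjective_map by blast
  moreover have "Y closure_of (f ` ?D) = topspace Y"
    using homeomorphic_map_closure_of[OF f D] homeomorphic_imp_surjective_map[OF f]
    by (simp add: closure_of_deleted_discrete_plank)
  moreover have "Lindelof_space (subtopology Y (f ` ?D))"
  proof (rule Lindelof_space_continuous_map_image)
    show "Lindelof_space (subtopology ?X ?D)"
      by (simp add: Lindelof_space_deleted_discrete_plank)
    show "continuous_map (subtopology ?X ?D) (subtopology Y (f ` ?D)) f"
    proof (rule continuous_map_into_subtopology)
      show "continuous_map (subtopology ?X ?D) Y f"
        using f homeomorphic_imp_continuous_map continuous_map_from_subtopology by blast
    qed (simp add: image_subset_iff_funcset[symmetric] image_mono)
    show "f ` topspace (subtopology ?X ?D) = topspace (subtopology Y (f ` ?D))"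
      using D f homeomorphic_imp_surjective_map[OF f] by (auto simp: Int_absorb1)
  qed
  moreover have "\<not> set_star_Lindelof_space Y"
    using set_star_Lindelof_space_homeomorphic_map[OF f]
      not_set_star_Lindelof_deleted_discrete_plank uncountable_UNIV_real by blast
  ultimately show ?thesis
    by blast
qed

end
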